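(* Let $(X,d)$ be a complete metric space, and let $T:X\to\mathcal{CB}(X)$ be a multi-valued mapping such that $$\mathcal{H}(Tx,Ty)\leq \eta(d(x,y))$$ for all $x,y\in X$, where $\eta:[0,\infty)\to[0,\infty)$ is a lower semicontinuous map such that $\eta(t)<t$ for all $t\in(0,+\infty)$ and $t\mapsto\frac{\eta(t)}{t}$ is non-decreasing on $(0,+\infty)$. Then $T$ has a fixed point.
   Context: $\mathcal{CB}(X)$ denotes the family of all nonempty closed and bounded subsets of $X$, and $\mathcal{H}$ is the Hausdorff metric on $\mathcal{CB}(X)$ induced by $d$: $\mathcal{H}(A,B)=\max\{\sup_{x\in B}d(x,A),\ \sup_{x\in A}d(x,B)\}$, where $d(x,A)=\inf_{a\in A}d(x,a)$. A fixed point of $T:X\to\mathcal{CB}(X)$ is a point $v\in X$ with $v\in Tv$. *)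

theory Defs
  imports "HOL-Analysis.Analysis"
begin

definition CB :: "'a::metric_space set set"
  where "CB = {A. A \<noteq> {} \<and> closed A \<and> bounded A}"

text \<open>On \<^const>\<open>CB\<close> both suprema are taken over nonempty sets of reals that are bounded
  above, and \<^const>\<open>infdist\<close> is a genuine infimum; outside \<^const>\<open>CB\<close> the value
  is unspecified or conventional.\<close>

definition hausdorff_dist :: "'a::metric_space set \<Rightarrow> 'a set \<Rightarrow> real"
  where "hausdorff_dist A B = max (SUP x\<in>B. infdist x A) (SUP x\<in>A. infdist x B)"

text \<open>Lower semicontinuity in the subspace topology of \<open>S\<close>.\<close>

definition lower_semicontinuous_on :: "'a::topological_space set \<Rightarrow> ('a \<Rightarrow> real) \<Rightarrow> bool"
  where "lower_semicontinuous_on S f \<longleftrightarrow>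
    (\<forall>t\<in>S. \<forall>c. c < f t \<longrightarrow> (\<forall>\<^sub>F s in at t within S. c < f s))"

definition fixed_point :: "('a \<Rightarrow> 'a set) \<Rightarrow> 'a \<Rightarrow> bool"
  where "fixed_point T v \<longleftrightarrow> v \<in> T v"

end

theory Submission
  imports Defs
begin

text \<open>
  The argument is an iteration in the style of Nadler's contraction principle, and the
  monotonicity of \<open>\<eta> t / t\<close> is what makes it work. Start from any \<open>x\<^sub>0\<close> and any point
  \<open>x\<^sub>1 \<in> T x\<^sub>0\<close>, and put \<open>r = dist x\<^sub>0 x\<^sub>1\<close>; if \<open>r = 0\<close>, then \<open>x\<^sub>0\<close> is fixed. On distances at most \<open>r\<close> the quotient \<open>\<eta> t / t\<close> is bounded by the single
  number \<open>\<eta> r / r < 1\<close>, so \<open>T\<close> behaves there like a set-valued contraction. With a factor \<open>q\<close>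
  strictly between that number and \<open>1\<close>, each \<open>y \<in> T x\<close> with \<open>dist x y \<le> r\<close> has a successor
  \<open>z \<in> T y\<close> with \<open>dist y z \<le> q * dist x y\<close> (\<open>nearby_point\<close>). The new step is again at most
  \<open>r\<close>, so the construction repeats forever, and the resulting orbit has geometrically
  decreasing steps and converges to some \<open>v\<close> (\<open>Cauchy_of_geometric_steps\<close>).

  In the limit only the nonexpansiveness of \<open>T\<close> matters: \<open>infdist x\<^bsub>n+1\<^esub> (T v)\<close> is at most
  \<open>dist x\<^bsub>n\<^esub> v\<close>, which tends to \<open>0\<close>; hence \<open>v\<close> has distance \<open>0\<close> from the closed set \<open>T v\<close>
  (\<open>limit_of_orbit_fixed\<close>).
\<close>

text \<open>Boundedness of both sets makes the supremum in the Hausdorff distance one of a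
  set that is bounded above, so each of its members lies below it.\<close>

lemma infdist_le_hausdorff_dist:
  assumes A: "A \<in> CB" and B: "B \<in> CB" and x: "x \<in> A"
  shows "infdist x B \<le> hausdorff_dist A B"
proof -
  obtain b where b: "b \<in> B" using B by (auto simp: CB_def)
  obtain e where e: "\<And>a. a \<in> A \<Longrightarrow> dist b a \<le> e"
    using A bounded_any_center[of A b] by (auto simp: CB_def)
  have "bdd_above ((\<lambda>a. infdist a B) ` A)"
  proof (rule bdd_aboveI2)
    show "infdist a B \<le> e" if "a \<in> A" for a
      using infdist_le[OF b, of a] e[OF that] by (simp add: dist_commute)
  qed
  then have "infdist x B \<le> (SUP a\<in>A. infdist a B)"
    using x by (intro cSUP_upper)
  then show ?thesis by (simp add: hausdorff_dist_def)
qed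

text \<open>The infimum defining the distance to a set need not be attained; a value strictly
  above it always is.\<close>

lemma nearby_point:
  assumes "B \<noteq> {}" and "infdist y B < c"
  obtains z where "z \<in> B" and "dist y z < c"
  using assms by (auto simp: infdist_def cINF_less_iff)

lemma Cauchy_of_geometric_steps:
  fixes X :: "nat \<Rightarrow> 'a::metric_space"
  assumes q: "0 \<le> q" "q < 1"
    and step: "\<And>n. dist (X (Suc n)) (X (Suc (Suc n))) \<le> q * dist (X n) (X (Suc n))"
  shows "Cauchy X"
proof -
  define r where "r = dist (X 0) (X (Suc 0))"
  have geo: "dist (X n) (X (Suc n)) \<le> r * q ^ n" for n
  proof (induction n)
    case (Suc n)
    have "q * dist (X n) (X (Suc n)) \<le> q * (r * q ^ n)"
      using Suc q(1) by (rule mult_left_mono)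
    with step[of n] show ?case by (simp add: mult_ac)
  qed (simp add: r_def)
  define S where "S n = (\<Sum>i<n. r * q ^ i)" for n
  have "summable (\<lambda>n. r * q ^ n)"
    using q by (intro summable_mult summable_geometric) simp
  then have "Cauchy S"
    unfolding S_def Cauchy_convergent_iff summable_iff_convergent .
  have dist_le: "dist (X m) (X n) \<le> S n - S m" if "m \<le> n" for m n
    using that
  proof (induction n rule: dec_induct)
    case (step n)
    then show ?case
      using dist_triangle[of "X m" "X (Suc n)" "X n"] geo[of n] by (simp add: S_def)
  qed simp
  show ?thesis
  proof (rule CauchyI')
    fix e :: real assume "e > 0"
    then obtain M where M: "\<And>m n. m \<ge> M \<Longrightarrow> n \<ge> M \<Longrightarrow> dist (S m) (S n) < e"
      using \<open>Cauchy S\<close> unfolding Cauchy_def by metis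
    have "dist (X m) (X n) < e" if "m \<ge> M" "n > m" for m n
      using dist_le[of m n] M[of m n] that by (simp add: dist_real_def)
    then show "\<exists>M. \<forall>m\<ge>M. \<forall>n>m. dist (X m) (X n) < e" by blast
  qed
qed

text \<open>The distance to \<open>T v\<close> is continuous, and along the orbit it is dominated by the
  vanishing \<open>dist (X n) v\<close>; closedness of \<open>T v\<close> turns distance zero into membership.\<close>

lemma limit_of_orbit_fixed:
  fixes X :: "nat \<Rightarrow> 'a::metric_space"
  assumes closed: "T v \<noteq> {}" "closed (T v)"
    and nonexpansive: "\<And>x y. y \<in> T x \<Longrightarrow> infdist y (T v) \<le> dist x v"
    and orbit: "\<And>n. X (Suc n) \<in> T (X n)"
    and lim: "X \<longlonglongrightarrow> v"
  shows "fixed_point T v"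
proof -
  have "(\<lambda>n. infdist (X (Suc n)) (T v)) \<longlonglongrightarrow> infdist v (T v)"
    using LIMSEQ_Suc[OF lim] by (rule tendsto_infdist)
  moreover have "(\<lambda>n. dist (X n) v) \<longlonglongrightarrow> 0"
    using lim tendsto_dist_iff by blast
  ultimately have "infdist v (T v) \<le> 0"
    by (rule LIMSEQ_le) (use nonexpansive[OF orbit] in blast)
  then have "infdist v (T v) = 0"
    using infdist_nonneg[of v "T v"] by linarith
  then show ?thesis
    using in_closed_iff_infdist_zero[OF closed(2,1)] by (simp add: fixed_point_def)
qed

theorem theorem2p2:
  fixes T :: "'a::complete_space \<Rightarrow> 'a set"
    and \<eta> :: "real \<Rightarrow> real"
  assumes "\<And>x. T x \<in> CB"
    and "\<And>t. t \<ge> 0 \<Longrightarrow> \<eta> t \<ge> 0"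
    and "lower_semicontinuous_on {0..} \<eta>"
    and "\<And>t. t > 0 \<Longrightarrow> \<eta> t < t"
    and "mono_on {0<..} (\<lambda>t. \<eta> t / t)"
    and "\<And>x y. hausdorff_dist (T x) (T y) \<le> \<eta> (dist x y)"
  shows "\<exists>v. fixed_point T v"
proof -
  have ne: "T x \<noteq> {}" and cl: "closed (T x)" for x
    using assms(1)[of x] by (auto simp: CB_def)
  have infdist_le_eta: "infdist y (T z) \<le> \<eta> (dist x z)" if "y \<in> T x" for x y z
    using infdist_le_hausdorff_dist[OF assms(1) assms(1) that, of z] assms(6)[of x z]
    by linarith
  obtain x0 x1 where x1: "x1 \<in> T x0" using ne by blast
  define r where "r = dist x0 x1"
  \<comment> \<open>If \<open>r = 0\<close> then \<open>x0\<close> is already fixed; the quotient is then \<open>0\<close> and \<open>q = 1 / 2\<close>, so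
    this case needs no separate treatment.\<close>
  define k where "k = \<eta> r / r"
  define q where "q = (1 + k) / 2"
  have "r \<ge> 0" by (simp add: r_def)
  then have "0 \<le> k" using assms(2)[of r] by (simp add: k_def)
  have "k < 1"
    using assms(4)[of r] \<open>r \<ge> 0\<close> by (cases "r = 0") (auto simp: k_def)
  have q: "0 \<le> q" "q < 1" "k < q"
    using \<open>0 \<le> k\<close> \<open>k < 1\<close> by (auto simp: q_def)
  have eta_less: "\<eta> t < q * t" if "0 < t" "t \<le> r" for t
  proof -
    have "\<eta> t / t \<le> k"
      unfolding k_def using assms(5) by (rule mono_onD) (use that in auto)
    then have "\<eta> t / t < q" using q(3) by linarith
    then show ?thesis using that by (simp add: field_simps)
  qed
  have successor: "\<exists>z. z \<in> T y \<and> dist y z \<le> q * dist x y"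
    if y: "y \<in> T x" and le: "dist x y \<le> r" for x y
  proof (cases "x = y")
    case True
    with y show ?thesis by auto
  next
    case False
    then have "infdist y (T y) < q * dist x y"
      using infdist_le_eta[OF y, of y] eta_less[of "dist x y"] le by simp
    then show ?thesis using nearby_point[OF ne] by (metis less_imp_le)
  qed
  \<comment> \<open>The choice of a successor depends on the length of the preceding step, so the recursion
    runs over pairs of consecutive orbit points.\<close>
  define P where "P p \<longleftrightarrow> snd p \<in> T (fst p) \<and> dist (fst p) (snd p) \<le> r" for p
  have "\<exists>f. \<forall>n. P (f n) \<and> (fst (f (Suc n)) = snd (f n) \<and>
      dist (fst (f (Suc n))) (snd (f (Suc n))) \<le> q * dist (fst (f n)) (snd (f n)))"
  proof (rule dependent_nat_choice)
    show "\<exists>p. P p" using x1 by (auto simp: P_def r_def)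
  next
    fix p :: "'a \<times> 'a" and n :: nat assume p: "P p"
    then obtain z where z: "z \<in> T (snd p)" "dist (snd p) z \<le> q * dist (fst p) (snd p)"
      using successor unfolding P_def by blast
    have "q * dist (fst p) (snd p) \<le> dist (fst p) (snd p)"
      using q by (simp add: mult_left_le_one_le)
    then show "\<exists>p'. P p' \<and> (fst p' = snd p \<and>
        dist (fst p') (snd p') \<le> q * dist (fst p) (snd p))"
      using z p by (intro exI[of _ "(snd p, z)"]) (auto simp: P_def)
  qed
  then obtain f where f: "\<And>n. P (f n)" "\<And>n. fst (f (Suc n)) = snd (f n)"
    "\<And>n. dist (fst (f (Suc n))) (snd (f (Suc n))) \<le> q * dist (fst (f n)) (snd (f n))"
    by blast
  define X where "X n = fst (f n)" for n
  have orbit: "X (Suc n) \<in> T (X n)" for n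
    using f(1)[of n] f(2)[of n] by (simp add: X_def P_def)
  have "dist (X (Suc n)) (X (Suc (Suc n))) \<le> q * dist (X n) (X (Suc n))" for n
    using f(3)[of n] f(2)[of n] f(2)[of "Suc n"] by (simp add: X_def)
  then have "Cauchy X" by (rule Cauchy_of_geometric_steps[OF q(1,2)])
  then obtain v where v: "X \<longlonglongrightarrow> v"
    using Cauchy_convergent convergent_def by blast
  \<comment> \<open>The orbit may pass through \<open>v\<close>. The bound \<open>\<eta> t < t\<close> concerns positive distances only,
    but a point of \<open>T x\<close> trivially has distance \<open>0\<close> from \<open>T v\<close> when \<open>x = v\<close>.\<close>
  have "infdist y (T v) \<le> dist x v" if "y \<in> T x" for x y
  proof (cases "x = v")
    case True
    with that show ?thesis by simp
  next
    case False
    then show ?thesis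
      using infdist_le_eta[OF that, of v] assms(4)[of "dist x v"] by simp
  qed
  then have "fixed_point T v"
    using ne cl orbit v by (intro limit_of_orbit_fixed)
  then show ?thesis by blast
qed

end
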